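(* Suppose fundamentals $w_i$ are perfectly correlated ($w_i=w$ for all $i$) and errors $e_i$ are independent. When $N$ is large, data intermediation is always profitable, $R(X)\ge 0$. However, for sufficiently small $\sigma$, the data externality is negative, $DE_i(X)<0$, and data sharing reduces social surplus, $\Delta W_i(X)<0$. These conclusions hold whether the intermediary collects complete data ($X=S$) or anonymized data ($X=A$).
   Context: There are many consumers $i=1,\dots,N$, with $N\ge2$. Consumer $i$ observes $s_i=w+\sigma e_i$, where $w$ (the common willingness to pay, $w_i=w$) has mean $\mu$ and variance $1$, the errors $e_i$ are independent and identically distributed with mean $0$ and variance $1$, independent of $w$, and $\sigma>0$. $S_i$ denotes the information $s_i$. Inflow policies: complete data $X=S=(s_1,\dots,s_N)$, with $X_{-i}=S_{-i}=(s_j)_{j\ne i}$; anonymized data $X=A$, a uniformly random permutation (independent of everything else) of the entries of $S$, with $X_{-i}=A_{-i}$ a uniformly random permutation of the entries of $S_{-i}$. $\varnothing$ denotes no information. Product market: facing unit price $p_i$, consumer $i$ buys $q_i$ with utility $w_iq_i-p_iq_i-\tfrac12q_i^2$; the producer's profit from $i$ is $(p_i-c)q_i$, $c\ge 0$. When consumer $i$ has information $I$ and the producer has information $Y_0$ (no finer than $I$), $p_i^*=\tfrac12(\mathbb E[w_i\mid Y_0]+c)$, $q_i^*=\mathbb E[w_i\mid I]-p_i^*$; $\Pi_i(I,Y_0)=\mathbb E[(p_i^*-c)q_i^*]$, $U_i(I,Y_0)=\mathbb E[w_iq_i^*-p_i^*q_i^*-\tfrac12(q_i^* )^2]$, $W_i=\Pi_i+U_i$.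 Data externality: $DE_i(X)=U_i((S_i,X_{-i}),X_{-i})-U_i(S_i,\varnothing)$. Effect of sharing on social surplus: $\Delta W_i(X)=W_i((S_i,X),X)-W_i(S_i,\varnothing)$. The intermediary's profit is $R(X)=\sum_i\big(\Pi_i((S_i,X),X)-\Pi_i(S_i,\varnothing)\big)-\sum_i\big(U_i((S_i,X_{-i}),X_{-i})-U_i((S_i,X),X)\big)$; intermediation with $X$ is profitable when $R(X)\ge0$. *)

theory Defs
  imports "HOL-Probability.Probability" "HOL-Combinatorics.Permutations"
begin

text \<open>
  An information structure is given by the set of real random variables that are observed;
  conditioning is on the sigma-algebra they generate. In particular \<open>info M {}\<close> is the trivial
  sigma-algebra, that is, no information.
\<close>

definition info :: "'a measure \<Rightarrow> ('a \<Rightarrow> real) set \<Rightarrow> 'a measure" where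
  "info M I = sigma (space M) {g -` B \<inter> space M | g B. g \<in> I \<and> B \<in> sets borel}"

definition estimate :: "'a measure \<Rightarrow> ('a \<Rightarrow> real) \<Rightarrow> ('a \<Rightarrow> real) set \<Rightarrow> 'a \<Rightarrow> real" where
  "estimate M v I = real_cond_exp M (info M I) v"

text \<open>
  One consumer with willingness to pay \<open>v\<close> and information \<open>I\<close>, facing a producer with marginal
  cost \<open>c\<close> and information \<open>Y \<subseteq> I\<close>.
\<close>

definition price :: "'a measure \<Rightarrow> real \<Rightarrow> ('a \<Rightarrow> real) \<Rightarrow> ('a \<Rightarrow> real) set \<Rightarrow> 'a \<Rightarrow> real" where
  "price M c v Y \<omega> = (estimate M v Y \<omega> + c) / 2"

definition quantity ::
  "'a measure \<Rightarrow> real \<Rightarrow> ('a \<Rightarrow> real) \<Rightarrow> ('a \<Rightarrow> real) set \<Rightarrow> ('a \<Rightarrow> real) set \<Rightarrow> 'a \<Rightarrow> real" where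
  "quantity M c v I Y \<omega> = estimate M v I \<omega> - price M c v Y \<omega>"

definition producer_profit ::
  "'a measure \<Rightarrow> real \<Rightarrow> ('a \<Rightarrow> real) \<Rightarrow> ('a \<Rightarrow> real) set \<Rightarrow> ('a \<Rightarrow> real) set \<Rightarrow> real" where
  "producer_profit M c v I Y = (\<integral>\<omega>. (price M c v Y \<omega> - c) * quantity M c v I Y \<omega> \<partial>M)"

definition consumer_surplus ::
  "'a measure \<Rightarrow> real \<Rightarrow> ('a \<Rightarrow> real) \<Rightarrow> ('a \<Rightarrow> real) set \<Rightarrow> ('a \<Rightarrow> real) set \<Rightarrow> real" where
  "consumer_surplus M c v I Y =
     (\<integral>\<omega>. v \<omega> * quantity M c v I Y \<omega> - price M c v Y \<omega> * quantity M c v I Y \<omega>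
           - (quantity M c v I Y \<omega>)\<^sup>2 / 2 \<partial>M)"

definition social_surplus ::
  "'a measure \<Rightarrow> real \<Rightarrow> ('a \<Rightarrow> real) \<Rightarrow> ('a \<Rightarrow> real) set \<Rightarrow> ('a \<Rightarrow> real) set \<Rightarrow> real" where
  "social_surplus M c v I Y = producer_profit M c v I Y + consumer_surplus M c v I Y"

definition signal :: "('a \<Rightarrow> real) \<Rightarrow> (nat \<Rightarrow> 'a \<Rightarrow> real) \<Rightarrow> real \<Rightarrow> nat \<Rightarrow> 'a \<Rightarrow> real" where
  "signal w e \<sigma> i \<omega> = w \<omega> + \<sigma> * e i \<omega>"

text \<open>
  An inflow policy maps the signals \<open>s\<close> and a set \<open>J\<close> of consumers to the data collected from \<open>J\<close>.
  For \<open>N\<close> consumers \<open>{..<N}\<close>, all the data is \<open>X s {..<N}\<close>, and the data of everyone but \<open>i\<close> is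
  \<open>X s ({..<N} - {i})\<close>. Under anonymization the \<open>k\<close>-th entry of the data from \<open>J\<close> is the signal of
  consumer \<open>perm J \<omega> k\<close>, where \<open>perm J\<close> is a random permutation of \<open>J\<close>.
\<close>

type_synonym 'a inflow = "(nat \<Rightarrow> 'a \<Rightarrow> real) \<Rightarrow> nat set \<Rightarrow> ('a \<Rightarrow> real) set"

definition complete_data :: "'a inflow" where
  "complete_data s J = {s j | j. j \<in> J}"

definition anonymized_data :: "(nat set \<Rightarrow> 'a \<Rightarrow> nat \<Rightarrow> nat) \<Rightarrow> 'a inflow" where
  "anonymized_data perm s J = {(\<lambda>\<omega>. s (perm J \<omega> k) \<omega>) | k. k \<in> J}"

definition data_externality ::
  "'a measure \<Rightarrow> real \<Rightarrow> ('a \<Rightarrow> real) \<Rightarrow> (nat \<Rightarrow> 'a \<Rightarrow> real) \<Rightarrow> real \<Rightarrow> nat \<Rightarrow> 'a inflow \<Rightarrow> nat \<Rightarrow> real" where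
  "data_externality M c w e \<sigma> N X i =
     (let s = signal w e \<sigma>; others = X s ({..<N} - {i}) in
        consumer_surplus M c w ({s i} \<union> others) others - consumer_surplus M c w {s i} {})"

definition social_surplus_change ::
  "'a measure \<Rightarrow> real \<Rightarrow> ('a \<Rightarrow> real) \<Rightarrow> (nat \<Rightarrow> 'a \<Rightarrow> real) \<Rightarrow> real \<Rightarrow> nat \<Rightarrow> 'a inflow \<Rightarrow> nat \<Rightarrow> real" where
  "social_surplus_change M c w e \<sigma> N X i =
     (let s = signal w e \<sigma>; all = X s {..<N} in
        social_surplus M c w ({s i} \<union> all) all - social_surplus M c w {s i} {})"

definition intermediary_profit ::
  "'a measure \<Rightarrow> real \<Rightarrow> ('a \<Rightarrow> real) \<Rightarrow> (nat \<Rightarrow> 'a \<Rightarrow> real) \<Rightarrow> real \<Rightarrow> nat \<Rightarrow> 'a inflow \<Rightarrow> real" where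
  "intermediary_profit M c w e \<sigma> N X =
     (let s = signal w e \<sigma>; all = X s {..<N}; others = (\<lambda>i. X s ({..<N} - {i})) in
        (\<Sum>i<N. producer_profit M c w ({s i} \<union> all) all - producer_profit M c w {s i} {})
      - (\<Sum>i<N. consumer_surplus M c w ({s i} \<union> others i) (others i)
               - consumer_surplus M c w ({s i} \<union> all) all))"

text \<open>
  The error sequence is infinite so that the number \<open>N\<close> of consumers can vary; an economy with \<open>N\<close>
  consumers only involves \<open>e i\<close> for \<open>i < N\<close>. No assumption is made on the joint distribution of
  \<open>perm J\<close> for different \<open>J\<close>. Variance 1 forces \<open>w\<close> and the \<open>e i\<close> to be square-integrable, since
  the Bochner integral of a non-integrable function is 0.
\<close>

locale common_value_economy = prob_space M for M :: "'a measure" +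
  fixes w :: "'a \<Rightarrow> real" and e :: "nat \<Rightarrow> 'a \<Rightarrow> real" and \<mu> c :: real
    and perm :: "nat set \<Rightarrow> 'a \<Rightarrow> nat \<Rightarrow> nat"
  assumes w_random_variable: "random_variable borel w"
    and w_mean: "expectation w = \<mu>"
    and w_variance: "variance w = 1"
    and e_indep: "indep_vars (\<lambda>_. borel) e UNIV"
    and e_identically_distributed: "\<And>i j. distr M borel (e i) = distr M borel (e j)"
    and e_mean: "\<And>i. expectation (e i) = 0"
    and e_variance: "\<And>i. variance (e i) = 1"
    and w_indep_e: "indep_set (sets (info M {w})) (sets (info M (range e)))"
    and cost_nonneg: "c \<ge> 0"
    and perm_random_variable: "\<And>J. finite J \<Longrightarrow> random_variable (count_space {p. p permutes J}) (perm J)"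
    and perm_uniform: "\<And>J. finite J \<Longrightarrow>
          distr M (count_space {p. p permutes J}) (perm J) = uniform_count_measure {p. p permutes J}"
    and perm_indep: "\<And>J. finite J \<Longrightarrow>
          indep_set (sets (vimage_algebra (space M) (perm J) (count_space {p. p permutes J})))
                    (sets (info M ({w} \<union> range e)))"

end

theory Submission
  imports Defs
begin

text \<open>
  All payoffs are affine in the second moments \<open>g(I) = E[E[w|I]\<^sup>2]\<close>: the profit is \<open>g(Y)/4\<close> and the
  consumer surplus is \<open>g(I)/2 - 3g(Y)/8\<close>, up to constants. No information gives \<open>g = \<mu>\<^sup>2\<close>, and
  always \<open>g \<le> \<mu>\<^sup>2 + 1\<close>. Conversely, the data collected from \<open>n\<close> consumers, complete or anonymized,
  determines the average of their signals, which predicts \<open>w\<close> with mean squared error \<open>\<sigma>\<^sup>2/n\<close>; hence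
  \<open>g \<ge> \<mu>\<^sup>2 + 1 - \<sigma>\<^sup>2/n\<close>. So for small \<open>\<sigma>\<close> a consumer learns almost nothing from others but loses
  about \<open>3/8\<close> (and society \<open>1/8\<close>) to price discrimination, while for large \<open>N\<close> the producer gains
  about \<open>1/4\<close> per consumer and the required compensation per consumer vanishes.
\<close>

section \<open>Information structures\<close>

lemma space_info [simp]: "space (info M I) = space M"
  unfolding info_def by (rule space_measure_of) auto

lemma sets_info:
  "sets (info M I) = sigma_sets (space M) {g -` B \<inter> space M | g B. g \<in> I \<and> B \<in> sets borel}"
  unfolding info_def by (rule sets_measure_of) auto

lemma subalgebra_info:
  assumes "I \<subseteq> borel_measurable M"
  shows "subalgebra M (info M I)"
  unfolding subalgebra_def sets_info
  using assms by (auto intro!: sets.sigma_sets_subset intro: measurable_sets)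

lemma subalgebra_info_mono: "Y \<subseteq> I \<Longrightarrow> subalgebra (info M I) (info M Y)"
  unfolding subalgebra_def sets_info by (auto intro!: sigma_sets_mono')

lemma measurable_info: "g \<in> I \<Longrightarrow> g \<in> borel_measurable (info M I)"
  by (rule measurableI) (auto simp: sets_info intro!: sigma_sets.Basic)

lemma sets_info_empty: "sets (info M {}) = {{}, space M}"
  by (simp add: sets_info sigma_sets_empty_eq)

section \<open>Payoffs in terms of the second moment of the estimate\<close>

text \<open>The pointwise bound |f g| <= f^2 + g^2 dominates the product. All cross terms in the
  payoffs are integrable for this reason.\<close>

lemma integrable_mult_of_squares:
  fixes f g :: "'a \<Rightarrow> real"
  assumes [measurable]: "f \<in> borel_measurable M" "g \<in> borel_measurable M"
    and "integrable M (\<lambda>x. (f x)\<^sup>2)" "integrable M (\<lambda>x. (g x)\<^sup>2)"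
  shows "integrable M (\<lambda>x. f x * g x)"
proof (rule Bochner_Integration.integrable_bound)
  show "integrable M (\<lambda>x. (f x)\<^sup>2 + (g x)\<^sup>2)"
    using assms by simp
  have "\<bar>f x * g x\<bar> \<le> (f x)\<^sup>2 + (g x)\<^sup>2" for x
  proof -
    have "0 \<le> (\<bar>f x\<bar> - \<bar>g x\<bar>)\<^sup>2" "0 \<le> \<bar>f x\<bar> * \<bar>g x\<bar>" by simp_all
    then show ?thesis
      unfolding abs_mult power2_diff power2_abs by linarith
  qed
  then show "AE x in M. norm (f x * g x) \<le> norm ((f x)\<^sup>2 + (g x)\<^sup>2)"
    by simp
qed simp

text \<open>The squared L2 norm of the conditional expectation, written g in the overview. It
  exceeds the variance of the estimate by the squared mean of \<open>v\<close>, so differences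
  between information sets are gains in explained variance.\<close>

definition explained :: "'a measure \<Rightarrow> ('a \<Rightarrow> real) \<Rightarrow> ('a \<Rightarrow> real) set \<Rightarrow> real" where
  "explained M v I = (\<integral>\<omega>. (estimate M v I \<omega>)\<^sup>2 \<partial>M)"

locale square_integrable_value = prob_space M for M :: "'a measure" +
  fixes v :: "'a \<Rightarrow> real"
  assumes value_measurable [measurable]: "v \<in> borel_measurable M"
    and value_square_integrable: "integrable M (\<lambda>x. (v x)\<^sup>2)"
begin

lemma value_integrable: "integrable M v"
  using square_integrable_imp_integrable[OF value_measurable value_square_integrable] .

section \<open>Conditional expectation as orthogonal projection in L2\<close>

lemma info_finite_measure_subalgebra:
  "I \<subseteq> borel_measurable M \<Longrightarrow> finite_measure_subalgebra M (info M I)"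
  by unfold_locales (rule subalgebra_info)

lemma estimate_measurable [measurable]:
  "estimate M v I \<in> borel_measurable (info M I)" "estimate M v I \<in> borel_measurable M"
  unfolding estimate_def by measurable

lemma estimate_square_integrable:
  assumes "I \<subseteq> borel_measurable M"
  shows "integrable M (\<lambda>x. (estimate M v I x)\<^sup>2)"
proof -
  interpret F: finite_measure_subalgebra M "info M I"
    using assms by (rule info_finite_measure_subalgebra)
  show ?thesis
    unfolding estimate_def
    \<comment> \<open>Conditional Jensen inequality for the convex function x^2.\<close>
    by (rule F.integrable_convex_cond_exp[where I = UNIV])
      (use value_integrable value_square_integrable convex_power2 in auto)
qed

lemma estimate_integrable:
  assumes "I \<subseteq> borel_measurable M"
  shows "integrable M (estimate M v I)"
  using square_integrable_imp_integrable[OF _ estimate_square_integrable[OF assms]] by simp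

lemma integral_estimate:
  assumes "I \<subseteq> borel_measurable M"
  shows "expectation (estimate M v I) = expectation v"
proof -
  interpret F: finite_measure_subalgebra M "info M I"
    using assms by (rule info_finite_measure_subalgebra)
  show ?thesis
    unfolding estimate_def by (rule F.real_cond_exp_int(2)[OF value_integrable])
qed

text \<open>Known factors can be pulled out of a conditional expectation; in L2 terms, the residual
  \<open>v - estimate M v I\<close> is orthogonal to everything the information determines.\<close>

lemma integral_mult_estimate:
  assumes I: "I \<subseteq> borel_measurable M" and u: "u \<in> borel_measurable (info M I)"
    and u2: "integrable M (\<lambda>x. (u x)\<^sup>2)"
  shows "(\<integral>x. u x * estimate M v I x \<partial>M) = (\<integral>x. u x * v x \<partial>M)"
proof -
  interpret F: finite_measure_subalgebra M "info M I"
    using I by (rule info_finite_measure_subalgebra)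
  have [measurable]: "u \<in> borel_measurable M"
    using u by (rule measurable_from_subalg[OF subalgebra_info[OF I]])
  show ?thesis
    unfolding estimate_def
    by (intro F.real_cond_exp_intg(2) integrable_mult_of_squares u u2 value_square_integrable) auto
qed

lemma integral_estimate_mult_value:
  assumes "I \<subseteq> borel_measurable M"
  shows "(\<integral>x. estimate M v I x * v x \<partial>M) = explained M v I"
  using integral_mult_estimate[OF assms estimate_measurable(1) estimate_square_integrable[OF assms]]
  by (simp add: explained_def power2_eq_square)

text \<open>Tower property: the coarser estimate is also measurable for the finer information, so it
  may serve as the test function in the orthogonality relation, once for \<open>I\<close> and once
  for \<open>Y\<close>.\<close>

lemma integral_estimate_mult_estimate:
  assumes I: "I \<subseteq> borel_measurable M" and "Y \<subseteq> I"
  shows "(\<integral>x. estimate M v Y x * estimate M v I x \<partial>M) = explained M v Y"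
proof -
  have Y: "Y \<subseteq> borel_measurable M" using assms by auto
  have "estimate M v Y \<in> borel_measurable (info M I)"
    using measurable_from_subalg[OF subalgebra_info_mono[OF \<open>Y \<subseteq> I\<close>]] estimate_measurable(1) .
  then show ?thesis
    using integral_mult_estimate[OF I _ estimate_square_integrable[OF Y]]
      integral_estimate_mult_value[OF Y] by simp
qed

lemma integral_quadratic:
  fixes f g :: "'a \<Rightarrow> real"
  assumes [measurable]: "f \<in> borel_measurable M" "g \<in> borel_measurable M"
    and f: "integrable M (\<lambda>x. (f x)\<^sup>2)" and g: "integrable M (\<lambda>x. (g x)\<^sup>2)"
  shows "integrable M (\<lambda>x. (f x - g x)\<^sup>2)"
    and "(\<integral>x. (f x - g x)\<^sup>2 \<partial>M)
      = (\<integral>x. (f x)\<^sup>2 \<partial>M) - 2 * (\<integral>x. f x * g x \<partial>M) + (\<integral>x. (g x)\<^sup>2 \<partial>M)"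
proof -
  have fg: "integrable M (\<lambda>x. f x * g x)"
    using assms by (rule integrable_mult_of_squares)
  have eq: "(f x - g x)\<^sup>2 = (f x)\<^sup>2 - 2 * (f x * g x) + (g x)\<^sup>2" for x
    by (simp add: power2_diff algebra_simps)
  show "integrable M (\<lambda>x. (f x - g x)\<^sup>2)" unfolding eq using f g fg by simp
  show "(\<integral>x. (f x - g x)\<^sup>2 \<partial>M)
      = (\<integral>x. (f x)\<^sup>2 \<partial>M) - 2 * (\<integral>x. f x * g x \<partial>M) + (\<integral>x. (g x)\<^sup>2 \<partial>M)"
    unfolding eq using f g fg by simp
qed

text \<open>The estimate is the best predictor in mean square, so any explicit predictor
  \<open>u\<close> bounds the explained part from below. Orthogonality turns the mean square of
  \<open>u - estimate M v I\<close> into this inequality.\<close>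

lemma explained_ge:
  assumes I: "I \<subseteq> borel_measurable M" and u: "u \<in> borel_measurable (info M I)"
    and u2: "integrable M (\<lambda>x. (u x)\<^sup>2)"
  shows "expectation (\<lambda>x. (v x)\<^sup>2) - expectation (\<lambda>x. (v x - u x)\<^sup>2) \<le> explained M v I"
proof -
  have [measurable]: "u \<in> borel_measurable M"
    using u by (rule measurable_from_subalg[OF subalgebra_info[OF I]])
  have "0 \<le> expectation (\<lambda>x. (u x - estimate M v I x)\<^sup>2)" by simp
  also have "\<dots> = expectation (\<lambda>x. (u x)\<^sup>2) - 2 * expectation (\<lambda>x. u x * v x) + explained M v I"
    using integral_quadratic(2)[OF _ _ u2 estimate_square_integrable[OF I]]
      integral_mult_estimate[OF assms] by (simp add: explained_def)
  finally show ?thesis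
    using integral_quadratic(2)[OF _ _ value_square_integrable u2] by (simp add: mult.commute)
qed

lemma explained_le:
  assumes I: "I \<subseteq> borel_measurable M"
  shows "explained M v I \<le> expectation (\<lambda>x. (v x)\<^sup>2)"
proof -
  have "0 \<le> expectation (\<lambda>x. (estimate M v I x - v x)\<^sup>2)" by simp
  also have "\<dots> = expectation (\<lambda>x. (v x)\<^sup>2) - explained M v I"
    using integral_quadratic(2)[OF _ _ estimate_square_integrable[OF I] value_square_integrable]
      integral_estimate_mult_value[OF I] by (simp add: explained_def)
  finally show ?thesis by simp
qed

lemma explained_empty: "explained M v {} = (expectation v)\<^sup>2"
proof -
  interpret F: finite_measure_subalgebra M "info M {}"
    by (rule info_finite_measure_subalgebra) simp
  have "AE x in M. estimate M v {} x = expectation v"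
    unfolding estimate_def
  \<comment> \<open>By uniqueness of the conditional expectation it suffices to compare integrals
    over the two sets of the trivial sigma-algebra.\<close>
  proof (rule F.real_cond_exp_charact)
    fix A assume "A \<in> sets (info M {})"
    then consider "A = {}" | "A = space M"
      by (auto simp: sets_info_empty)
    then show "(\<integral>x\<in>A. v x \<partial>M) = (\<integral>x\<in>A. expectation v \<partial>M)"
      proof cases
      case 1
      then show ?thesis by (simp add: set_lebesgue_integral_def)
    next
      case 2
      then show ?thesis by (simp add: set_integral_space value_integrable prob_space)
    qed
  qed (simp_all add: value_integrable)
  then have "explained M v {} = (\<integral>x. (expectation v)\<^sup>2 \<partial>M)"
    unfolding explained_def by (intro integral_cong_AE) auto
  then show ?thesis by (simp add: prob_space)
qed

section \<open>Closed forms of profit and consumer surplus\<close>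

lemma producer_profit_eq:
  assumes I: "I \<subseteq> borel_measurable M" and YI: "Y \<subseteq> I"
  shows "producer_profit M c v I Y = (explained M v Y - 2 * c * expectation v + c\<^sup>2) / 4"
proof -
  have Y: "Y \<subseteq> borel_measurable M" using assms by auto
  let ?a = "estimate M v I" and ?b = "estimate M v Y"
  note int = estimate_square_integrable[OF I] estimate_square_integrable[OF Y]
    estimate_integrable[OF I] estimate_integrable[OF Y]
  have ba: "integrable M (\<lambda>x. ?b x * ?a x)"
    by (intro integrable_mult_of_squares int estimate_measurable)
  \<comment> \<open>By the tower property the cross term integrates to
    \<open>explained M v Y\<close>, so the coefficient becomes 1/2 - 1/4 = 1/4 and the consumer's
    information \<open>I\<close> drops out.\<close>
  have "(price M c v Y x - c) * quantity M c v I Y x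
      = (?b x * ?a x) / 2 - (?b x)\<^sup>2 / 4 - c / 2 * ?a x + c\<^sup>2 / 4" for x
    by (simp add: price_def quantity_def field_simps power2_eq_square)
  then have "producer_profit M c v I Y
      = explained M v Y / 2 - explained M v Y / 4 - c / 2 * expectation v + c\<^sup>2 / 4"
    unfolding producer_profit_def
    using int ba integral_estimate_mult_estimate[OF I YI] integral_estimate[OF I]
    by (simp add: prob_space explained_def)
  then show ?thesis by (simp add: field_simps)
qed

lemma consumer_surplus_eq:
  assumes I: "I \<subseteq> borel_measurable M" and YI: "Y \<subseteq> I"
  shows "consumer_surplus M c v I Y
    = explained M v I / 2 - 3 / 8 * explained M v Y + (c\<^sup>2 - 2 * c * expectation v) / 8"
proof -
  have Y: "Y \<subseteq> borel_measurable M" using assms by auto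
  let ?a = "estimate M v I" and ?b = "estimate M v Y"
  note int = estimate_square_integrable[OF I] estimate_square_integrable[OF Y]
    estimate_integrable[OF I] estimate_integrable[OF Y] value_integrable
  have ba: "integrable M (\<lambda>x. ?b x * ?a x)" "integrable M (\<lambda>x. ?a x * v x)"
    "integrable M (\<lambda>x. ?b x * v x)"
    by (intro integrable_mult_of_squares int value_square_integrable estimate_measurable value_measurable)+
  \<comment> \<open>With estimate a, price p and quantity q = a - p, the identity p q + q^2/2 = (a^2
    - p^2)/2 removes the products of the two estimates. The weight of \<open>explained M v Y\<close>
    is then -1/2 + 1/8 = -3/8.\<close>
  have "v x * quantity M c v I Y x - price M c v Y x * quantity M c v I Y x
        - (quantity M c v I Y x)\<^sup>2 / 2
      = ?a x * v x - (?b x * v x) / 2 - c / 2 * v x - (?a x)\<^sup>2 / 2 + (?b x)\<^sup>2 / 8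
        + c / 4 * ?b x + c\<^sup>2 / 8" for x
    by (simp add: price_def quantity_def field_simps power2_eq_square)
  then have "consumer_surplus M c v I Y
      = explained M v I - explained M v Y / 2 - c / 2 * expectation v - explained M v I / 2
        + explained M v Y / 8 + c / 4 * expectation v + c\<^sup>2 / 8"
    unfolding consumer_surplus_def
    using int ba integral_estimate[OF Y] integral_estimate_mult_value[OF I]
      integral_estimate_mult_value[OF Y]
    by (simp add: prob_space explained_def)
  then show ?thesis by (simp add: field_simps)
qed

end

section \<open>The common value economy\<close>

lemma (in prob_space) square_integrable_if_variance_nonzero:
  assumes [measurable]: "random_variable borel X" and "variance X \<noteq> (0::real)"
  shows "integrable M (\<lambda>x. (X x)\<^sup>2)"
proof -
  define m where "m = expectation X"
  \<comment> \<open>A non-integrable square would have Bochner integral 0, contradicting the nonzero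
    variance.\<close>
  have 1: "integrable M (\<lambda>x. (X x - m)\<^sup>2)"
    by (rule ccontr) (use assms(2) in \<open>simp add: not_integrable_integral_eq flip: m_def\<close>)
  have 2: "integrable M (\<lambda>x. X x - m)"
    by (rule square_integrable_imp_integrable[OF _ 1]) measurable
  have eq: "(X x)\<^sup>2 = (X x - m)\<^sup>2 + (2 * m) * (X x - m) + m\<^sup>2" for x
    by (simp add: power2_eq_square algebra_simps)
  show ?thesis
    unfolding eq by (intro Bochner_Integration.integrable_add integrable_mult_right 1 2 integrable_const)
qed

lemma others_nonempty: "{..<N} - {i} \<noteq> {}" if "N \<ge> 2" for N i :: nat
proof -
  have "(if i = 0 then 1 else 0) \<in> {..<N} - {i}" using that by auto
  then show ?thesis by blast
qed

context common_value_economy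
begin

sublocale square_integrable_value M w
proof unfold_locales
  show "integrable M (\<lambda>x. (w x)\<^sup>2)"
    using w_variance by (intro square_integrable_if_variance_nonzero[OF w_random_variable]) simp
qed (rule w_random_variable)

section \<open>Second moments of the common value and the errors\<close>

lemma w_second_moment: "expectation (\<lambda>x. (w x)\<^sup>2) = 1 + \<mu>\<^sup>2"
  using variance_eq[OF value_integrable value_square_integrable] w_variance w_mean by simp

lemma e_measurable [measurable]: "e i \<in> borel_measurable M"
  using e_indep by (auto simp: indep_vars_def)

lemma e_square_integrable: "integrable M (\<lambda>x. (e i x)\<^sup>2)"
  using e_variance by (intro square_integrable_if_variance_nonzero[OF e_measurable]) simp

lemma e_integrable: "integrable M (e i)"
  using square_integrable_imp_integrable[OF e_measurable e_square_integrable] .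

text \<open>The errors are orthonormal in L2: independence and mean zero off the diagonal, unit
  variance on it.\<close>

lemma e_mult: "integrable M (\<lambda>x. e i x * e j x)"
  "expectation (\<lambda>x. e i x * e j x) = (if i = j then 1 else 0)"
proof -
  show "integrable M (\<lambda>x. e i x * e j x)"
    by (intro integrable_mult_of_squares e_measurable e_square_integrable)
  show "expectation (\<lambda>x. e i x * e j x) = (if i = j then 1 else 0)"
  proof (cases "i = j")
    case True
    then show ?thesis using e_variance[of i] e_mean[of i] by (simp add: power2_eq_square)
  next
    case False
    have "expectation (\<lambda>x. \<Prod>k\<in>{i, j}. e k x) = (\<Prod>k\<in>{i, j}. expectation (e k))"
      by (intro indep_vars_lebesgue_integral indep_vars_subset[OF e_indep] e_integrable) auto
    then show ?thesis using False e_mean by simp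
  qed
qed

lemma sum_e_second_moment:
  assumes "finite J"
  shows "integrable M (\<lambda>x. (\<Sum>j\<in>J. e j x)\<^sup>2)"
    and "expectation (\<lambda>x. (\<Sum>j\<in>J. e j x)\<^sup>2) = real (card J)"
  using assms by (simp_all add: power2_eq_square sum_product e_mult)

section \<open>What the collected data reveals\<close>

lemma signal_measurable [measurable]: "signal w e \<sigma> i \<in> borel_measurable M"
  unfolding signal_def[abs_def] by measurable

lemma perm_permutes: "finite J \<Longrightarrow> \<omega> \<in> space M \<Longrightarrow> perm J \<omega> permutes J"
  using measurable_space[OF perm_random_variable] by auto

text \<open>The permutation takes finitely many values, so the entry is glued from finitely many
  measurable pieces, one for each fixed permutation.\<close>

lemma permuted_signal_measurable:
  assumes J: "finite J"
  shows "(\<lambda>\<omega>. signal w e \<sigma> (perm J \<omega> k) \<omega>) \<in> borel_measurable M"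
  by (rule measurable_compose_countable'[OF _ perm_random_variable[OF J], where f = "\<lambda>p. signal w e \<sigma> (p k)"])
    (simp_all add: J countable_finite finite_permutations)

lemma inflow_measurable:
  assumes "X \<in> {complete_data, anonymized_data perm}" "finite J"
  shows "X (signal w e \<sigma>) J \<subseteq> borel_measurable M"
  using assms permuted_signal_measurable
  by (auto simp: complete_data_def anonymized_data_def)

text \<open>A sum is invariant under permutation, so shuffling hides identities but not the sum of
  the signals. This is why complete and anonymized data can be treated alike.\<close>

lemma sum_signals_measurable:
  assumes X: "X \<in> {complete_data, anonymized_data perm}" and J: "finite J"
  shows "(\<lambda>\<omega>. \<Sum>j\<in>J. signal w e \<sigma> j \<omega>) \<in> borel_measurable (info M (X (signal w e \<sigma>) J))"
proof (cases "X = complete_data")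
  case True
  show ?thesis
    unfolding True by (intro borel_measurable_sum measurable_info) (auto simp: complete_data_def)
next
  case False
  then have X: "X = anonymized_data perm" using X by simp
  have "(\<lambda>\<omega>. \<Sum>k\<in>J. signal w e \<sigma> (perm J \<omega> k) \<omega>)
      \<in> borel_measurable (info M (X (signal w e \<sigma>) J))"
    unfolding X by (intro borel_measurable_sum measurable_info) (auto simp: anonymized_data_def)
  moreover have "(\<Sum>k\<in>J. signal w e \<sigma> (perm J \<omega> k) \<omega>) = (\<Sum>j\<in>J. signal w e \<sigma> j \<omega>)"
    if "\<omega> \<in> space M" for \<omega>
    by (rule sum.reindex_bij_betw[OF permutes_imp_bij[OF perm_permutes[OF J that]]])
  ultimately show ?thesis
    by (subst measurable_cong) (auto simp: eq_commute)
qed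

text \<open>The average signal is used as predictor; its error is \<sigma>/n times a sum of n
  orthonormal errors. \<open>I\<close> may be larger than the data, so that the bound also covers a
  consumer who adds the own signal.\<close>

lemma explained_ge_of_inflow:
  assumes X: "X \<in> {complete_data, anonymized_data perm}" and J: "finite J" "J \<noteq> {}"
    and I: "I \<subseteq> borel_measurable M" "X (signal w e \<sigma>) J \<subseteq> I"
  shows "1 + \<mu>\<^sup>2 - \<sigma>\<^sup>2 / card J \<le> explained M w I"
proof -
  define n where "n = real (card J)"
  have n: "n > 0" using J by (simp add: n_def card_gt_0_iff)
  define u where "u \<omega> = (\<Sum>j\<in>J. signal w e \<sigma> j \<omega>) / n" for \<omega>
  \<comment> \<open>The double negation gives the difference form required by
    \<open>integral_quadratic\<close>.\<close>
  have u_eq: "u \<omega> = w \<omega> - (- (\<sigma> / n)) * (\<Sum>j\<in>J. e j \<omega>)" for \<omega>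
    using n by (simp add: u_def signal_def sum.distrib n_def field_simps flip: sum_distrib_left)
  have u: "u \<in> borel_measurable (info M I)"
    unfolding u_def
    using measurable_from_subalg[OF subalgebra_info_mono[OF I(2)] sum_signals_measurable[OF X J(1)]]
    by simp
  have "integrable M (\<lambda>x. (- (\<sigma> / n) * (\<Sum>j\<in>J. e j x))\<^sup>2)"
    unfolding power_mult_distrib using sum_e_second_moment(1)[OF J(1)] by (rule integrable_mult_right)
  then have u2: "integrable M (\<lambda>x. (u x)\<^sup>2)"
    unfolding u_eq
    by (intro integral_quadratic(1) value_square_integrable) auto
  have "expectation (\<lambda>x. (w x - u x)\<^sup>2) = (\<sigma> / n)\<^sup>2 * n"
    by (simp add: u_eq power_mult_distrib power_divide sum_e_second_moment(2)[OF J(1)] flip: n_def)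
  also have "\<dots> = \<sigma>\<^sup>2 / n" using n by (simp add: power2_eq_square)
  finally show ?thesis
    using explained_ge[OF I(1) u u2] by (simp add: w_second_moment n_def)
qed

lemma explained_le_second_moment: "I \<subseteq> borel_measurable M \<Longrightarrow> explained M w I \<le> 1 + \<mu>\<^sup>2"
  using explained_le w_second_moment by simp

section \<open>Profitability and welfare bounds\<close>

lemma intermediary_profit_nonneg:
  assumes X: "X \<in> {complete_data, anonymized_data perm}" and N: "N \<ge> 2" "9 * \<sigma>\<^sup>2 \<le> 2 * (real N - 1)"
  shows "intermediary_profit M c w e \<sigma> N X \<ge> 0"
proof -
  define s where "s = signal w e \<sigma>"
  define D where "D = X s {..<N}"
  define rest where "rest i = X s ({..<N} - {i})" for i
  \<comment> \<open>\<open>r\<close> bounds the mean squared error for the data of all consumers and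
    of all but one. Per consumer, the profit gain is at least (1 - r)/4 and the compensation at most
    r/2 + 3r/8, leaving at least 1/4 - 9r/8; hence the condition 9r <= 2.\<close>
  define r where "r = \<sigma>\<^sup>2 / (real N - 1)"
  have r: "9 * r \<le> 2" using N by (simp add: r_def field_simps)
  have D: "D \<subseteq> borel_measurable M" and rest: "rest i \<subseteq> borel_measurable M" and s: "s i \<in> borel_measurable M" for i
    using inflow_measurable[OF X] by (auto simp: D_def rest_def s_def)
  have sD: "{s i} \<union> D \<subseteq> borel_measurable M" and srest: "{s i} \<union> rest i \<subseteq> borel_measurable M" for i
    using D rest s by auto
  have "0 \<le> (producer_profit M c w ({s i} \<union> D) D - producer_profit M c w {s i} {})
      - (consumer_surplus M c w ({s i} \<union> rest i) (rest i) - consumer_surplus M c w ({s i} \<union> D) D)"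
    if i: "i < N" for i
  proof -
    have "\<sigma>\<^sup>2 / real N \<le> r"
      unfolding r_def using N by (intro divide_left_mono) auto
    then have lower: "1 + \<mu>\<^sup>2 - r \<le> explained M w D" "1 + \<mu>\<^sup>2 - r \<le> explained M w ({s i} \<union> D)"
      using explained_ge_of_inflow[OF X, of "{..<N}" D \<sigma>]
        explained_ge_of_inflow[OF X, of "{..<N}" "{s i} \<union> D" \<sigma>] D sD[of i] N
      by (fastforce simp: D_def s_def lessThan_empty_iff)+
    have "real (card ({..<N} - {i})) = real N - 1"
      using i by (simp add: of_nat_diff)
    moreover have "{..<N} - {i} \<noteq> {}"
      using N(1) by (rule others_nonempty)
    ultimately have "1 + \<mu>\<^sup>2 - r \<le> explained M w (rest i)"
      using explained_ge_of_inflow[OF X, of "{..<N} - {i}" "rest i" \<sigma>] rest[of i]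
      by (simp add: r_def rest_def s_def)
    moreover have "explained M w ({s i} \<union> rest i) \<le> 1 + \<mu>\<^sup>2" "explained M w D \<le> 1 + \<mu>\<^sup>2"
      using explained_le_second_moment srest D by auto
    ultimately show ?thesis
      using lower r s
      unfolding producer_profit_eq[OF sD Un_upper2] consumer_surplus_eq[OF sD Un_upper2]
        consumer_surplus_eq[OF srest Un_upper2]
      by (simp add: producer_profit_eq explained_empty w_mean field_simps)
  qed
  then have "0 \<le> (\<Sum>i<N. (producer_profit M c w ({s i} \<union> D) D - producer_profit M c w {s i} {})
      - (consumer_surplus M c w ({s i} \<union> rest i) (rest i) - consumer_surplus M c w ({s i} \<union> D) D))"
    by (intro sum_nonneg) auto
  then show ?thesis
    by (simp add: intermediary_profit_def Let_def sum_subtractf D_def rest_def s_def)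
qed

text \<open>With K = 1 + \<mu>^2, the own signal and any nonempty data each explain between K -
  \<sigma>^2 and K. The externality is then at most (7\<sigma>^2 - 3)/8 and the surplus change at
  most (5\<sigma>^2 - 1)/8; the second bound dictates the hypothesis on \<sigma>.\<close>

lemma externality_and_surplus_change_neg:
  assumes X: "X \<in> {complete_data, anonymized_data perm}" and N: "N \<ge> 2" and i: "i < N"
    and \<sigma>: "5 * \<sigma>\<^sup>2 < 1"
  shows "data_externality M c w e \<sigma> N X i < 0 \<and> social_surplus_change M c w e \<sigma> N X i < 0"
proof -
  define s where "s = signal w e \<sigma>"
  have s: "s i \<in> borel_measurable M"
    by (simp add: s_def)
  \<comment> \<open>The own signal alone is the complete data of the one-consumer set
    \<open>{i}\<close>.\<close>
  have own: "1 + \<mu>\<^sup>2 - \<sigma>\<^sup>2 \<le> explained M w {s i}"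
    using explained_ge_of_inflow[of complete_data "{i}" "{s i}" \<sigma>] s
    by (simp add: complete_data_def s_def)
  have bounds: "X s J \<subseteq> borel_measurable M" "{s i} \<union> X s J \<subseteq> borel_measurable M"
      "1 + \<mu>\<^sup>2 - \<sigma>\<^sup>2 \<le> explained M w (X s J)" "explained M w ({s i} \<union> X s J) \<le> 1 + \<mu>\<^sup>2"
    if J: "finite J" "J \<noteq> {}" for J
  proof -
    show XJ: "X s J \<subseteq> borel_measurable M"
      using inflow_measurable[OF X J(1)] by (simp add: s_def)
    then show sXJ: "{s i} \<union> X s J \<subseteq> borel_measurable M"
      using s by simp
    then show "explained M w ({s i} \<union> X s J) \<le> 1 + \<mu>\<^sup>2"
      by (rule explained_le_second_moment)
    \<comment> \<open>Replacing the number of signals by 1 makes the bound, and so the threshold for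
      \<sigma>, independent of \<open>N\<close>.\<close>
    have "1 \<le> card J" using J by (simp add: Suc_le_eq card_gt_0_iff)
    then have "\<sigma>\<^sup>2 / card J \<le> \<sigma>\<^sup>2 / 1" by (intro divide_left_mono) auto
    then show "1 + \<mu>\<^sup>2 - \<sigma>\<^sup>2 \<le> explained M w (X s J)"
      using explained_ge_of_inflow[OF X J, of "X s J" \<sigma>] XJ by (simp add: s_def)
  qed
  have others: "finite ({..<N} - {i})" "{..<N} - {i} \<noteq> {}"
    using others_nonempty[OF N] by auto
  have all: "finite {..<N}" "{..<N} \<noteq> {}"
    using i by auto
  have "data_externality M c w e \<sigma> N X i < 0"
    using bounds(3,4)[OF others] own \<sigma> s
    by (simp add: data_externality_def Let_def flip: s_def)
      (simp add: consumer_surplus_eq bounds(2)[OF others, simplified] subset_insertI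
        explained_empty w_mean field_simps)
  moreover have "social_surplus_change M c w e \<sigma> N X i < 0"
    using bounds(3,4)[OF all] own \<sigma> s
    by (simp add: social_surplus_change_def social_surplus_def Let_def flip: s_def)
      (simp add: consumer_surplus_eq producer_profit_eq bounds(2)[OF all, simplified] subset_insertI
        explained_empty w_mean field_simps)
  ultimately show ?thesis ..
qed

end

theorem corollary2:
  fixes M :: "'a measure" and w :: "'a \<Rightarrow> real" and e :: "nat \<Rightarrow> 'a \<Rightarrow> real" and \<mu> c :: real
    and perm :: "nat set \<Rightarrow> 'a \<Rightarrow> nat \<Rightarrow> nat"
  assumes "common_value_economy M w e \<mu> c perm"
  shows "(\<forall>X\<in>{complete_data, anonymized_data perm}. \<forall>\<sigma>>0. \<exists>N\<^sub>0. \<forall>N\<ge>2. N \<ge> N\<^sub>0 \<longrightarrow>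
            intermediary_profit M c w e \<sigma> N X \<ge> 0) \<and>
         (\<exists>\<sigma>\<^sub>0>0. \<forall>\<sigma>. 0 < \<sigma> \<and> \<sigma> < \<sigma>\<^sub>0 \<longrightarrow>
            (\<forall>X\<in>{complete_data, anonymized_data perm}. \<forall>N\<ge>2. \<forall>i<N.
               data_externality M c w e \<sigma> N X i < 0 \<and> social_surplus_change M c w e \<sigma> N X i < 0))"
proof -
  interpret common_value_economy M w e \<mu> c perm by fact
  have "\<exists>N\<^sub>0. \<forall>N\<ge>2. N \<ge> N\<^sub>0 \<longrightarrow> intermediary_profit M c w e \<sigma> N X \<ge> 0"
    if X: "X \<in> {complete_data, anonymized_data perm}" for X \<sigma>
  proof -
    obtain N\<^sub>0 :: nat where "9 * \<sigma>\<^sup>2 / 2 + 1 \<le> real N\<^sub>0"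
      using real_arch_simple by blast
    then have "9 * \<sigma>\<^sup>2 \<le> 2 * (real N - 1)" if "N \<ge> N\<^sub>0" for N
      using of_nat_mono[OF that, where 'a = real] by simp
    then show ?thesis
      using intermediary_profit_nonneg[OF X] by blast
  qed
  \<comment> \<open>The threshold 2/5 is a rational number below 1/sqrt 5: 5 * (2/5)^2 = 4/5 <
    1.\<close>
  moreover have "5 * \<sigma>\<^sup>2 < 1" if "0 < \<sigma>" "\<sigma> < 2 / 5" for \<sigma> :: real
    using power_strict_mono[of \<sigma> "2 / 5" 2] that by (simp add: power2_eq_square)
  then have "\<forall>\<sigma>. 0 < \<sigma> \<and> \<sigma> < 2 / 5 \<longrightarrow>
      (\<forall>X\<in>{complete_data, anonymized_data perm}. \<forall>N\<ge>2. \<forall>i<N.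
         data_externality M c w e \<sigma> N X i < 0 \<and> social_surplus_change M c w e \<sigma> N X i < 0)"
    using externality_and_surplus_change_neg by blast
  then have "\<exists>\<sigma>\<^sub>0>0. \<forall>\<sigma>. 0 < \<sigma> \<and> \<sigma> < \<sigma>\<^sub>0 \<longrightarrow>
      (\<forall>X\<in>{complete_data, anonymized_data perm}. \<forall>N\<ge>2. \<forall>i<N.
         data_externality M c w e \<sigma> N X i < 0 \<and> social_surplus_change M c w e \<sigma> N X i < 0)"
    by (intro exI[of _ "2 / 5"]) simp
  ultimately show ?thesis by blast
qed

end
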